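(* Let $A=A_1,\dots,A_n$ be a sequence of objects from a totally ordered set with LIS length $k$. The following parallel algorithm computes the rank of every object (and hence the LIS length of $A$) in $O(n\log k)$ work and $O(k\log n)$ span. Build a tournament tree $\mathcal{T}$ (a complete binary tree stored implicitly in an array, with the objects of $A$ at the leaves in order and each internal node storing the minimum of its two children; the number of leaves is rounded up to a power of two by padding with $+\infty$). For rounds $r=1,2,\dots$ while the root value is not $+\infty$: call $\textsc{PrefixMin}(\mathrm{root},+\infty)$, where $\textsc{PrefixMin}(v,\mathit{LMin})$ does the following: if the value at $v$ exceeds $\mathit{LMin}$, return; if $v$ is a leaf, set the rank of its object to $r$ and set its value to $+\infty$; otherwise, in parallel call $\textsc{PrefixMin}(\mathrm{left}(v),\mathit{LMin})$ and $\textsc{PrefixMin}(\mathrm{right}(v),\min(\mathit{LMin},\text{value at }\mathrm{left}(v)))$ (the latter using the left child's value before the calls), and then set the value at $v$ to the minimum of its children's values.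
   Context: The rank of $A_i$ is the length of a longest strictly increasing subsequence of $A_1,\dots,A_i$ ending at $A_i$. The LIS length $k$ of $A$ is the maximum rank. Model of computation: the binary-forking work-span model (shared-memory threads, each a sequential RAM that can fork two parallel child threads; work = total number of operations, span = longest chain of sequentially dependent operations). $\log x$ denotes $1+\log_2(x+1)$.
   Formalization: A node value +∞ counts as exceeding every LMin, also +∞; with the strict order, A=1,2 fails (round 2 overwrites the rank of A_1 by 2). The O-constants are stated per totally ordered set; those for the naturals serve all, as any finite sequence is order-isomorphic to one of naturals. *)

theory Defs
  imports Complex_Main "HOL-Library.Extended"
begin

section \<open>Ranks\<close>

text \<open>
  The object \<open>A_i\<close> is \<open>A ! (i - 1)\<close>. A subsequence is given by its set of positions.
\<close>

definition lis_rank :: "'a::linorder list \<Rightarrow> nat \<Rightarrow> nat" where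
  "lis_rank A i = Max {card I |I. I \<subseteq> {..i} \<and> i \<in> I \<and> strict_mono_on I (\<lambda>j. A ! j)}"

definition lis_length :: "'a::linorder list \<Rightarrow> nat" where
  "lis_length A = Max (lis_rank A ` {..<length A})"

definition lg :: "nat \<Rightarrow> real" where
  "lg x = 1 + log 2 (real x + 1)"


section \<open>The binary-forking model\<close>

text \<open>
  Code of a thread, over locations \<^typ>\<open>'l\<close> and words \<^typ>\<open>'v\<close> of the shared memory and
  procedure names \<^typ>\<open>'c\<close>. Each constructor other than \<open>Halt\<close> stands for one operation of
  constant cost, with the rest of the code as its last argument. \<open>Local\<close> is one comparison or
  arithmetic operation on values that the thread holds; the model does not force a program to
  issue it, so a program has to be read with the number of such operations in mind.
  \<open>Fork p q r\<close> runs the two child threads \<open>p\<close> and \<open>q\<close> and, once both have halted, continues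
  with \<open>r\<close>.
\<close>

datatype ('l, 'v, 'c) prog =
    Halt
  | Local "('l, 'v, 'c) prog"
  | Read 'l "'v \<Rightarrow> ('l, 'v, 'c) prog"
  | Write 'l 'v "('l, 'v, 'c) prog"
  | Call 'c "('l, 'v, 'c) prog"
  | Fork "('l, 'v, 'c) prog" "('l, 'v, 'c) prog" "('l, 'v, 'c) prog"

primrec seq :: "('l, 'v, 'c) prog \<Rightarrow> ('l, 'v, 'c) prog \<Rightarrow> ('l, 'v, 'c) prog" where
  "seq Halt k = k"
| "seq (Local p) k = Local (seq p k)"
| "seq (Read l f) k = Read l (\<lambda>v. seq (f v) k)"
| "seq (Write l v p) k = Write l v (seq p k)"
| "seq (Call c p) k = Call c (seq p k)"
| "seq (Fork p q r) k = Fork p q (seq r k)"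

text \<open>
  The number in \<open>Thread d p\<close> is the length of the longest chain of sequentially dependent
  operations that leads to the present point of that thread. In \<open>Join s t r\<close> the parent thread
  waits for the two children \<open>s\<close> and \<open>t\<close>, to continue with \<open>r\<close>.
\<close>

datatype ('l, 'v, 'c) state =
    Thread nat "('l, 'v, 'c) prog"
  | Join "('l, 'v, 'c) state" "('l, 'v, 'c) state" "('l, 'v, 'c) prog"

text \<open>
  One operation of any one of the live threads (arbitrary interleaving). The work of an execution
  is therefore its number of steps.
\<close>

inductive step ::
  "('c \<Rightarrow> ('l, 'v, 'c) prog) \<Rightarrow>
   ('l, 'v, 'c) state \<times> ('l \<Rightarrow> 'v) \<Rightarrow> ('l, 'v, 'c) state \<times> ('l \<Rightarrow> 'v) \<Rightarrow> bool"
  for P where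
  step_local: "step P (Thread d (Local p), m) (Thread (d + 1) p, m)"
| step_read: "step P (Thread d (Read l f), m) (Thread (d + 1) (f (m l)), m)"
| step_write: "step P (Thread d (Write l v p), m) (Thread (d + 1) p, m(l := v))"
| step_call: "step P (Thread d (Call c p), m) (Thread (d + 1) (seq (P c) p), m)"
| step_fork: "step P (Thread d (Fork p q r), m)
                (Join (Thread (d + 1) p) (Thread (d + 1) q) r, m)"
| step_left: "step P (s, m) (s', m') \<Longrightarrow> step P (Join s t r, m) (Join s' t r, m')"
| step_right: "step P (t, m) (t', m') \<Longrightarrow> step P (Join s t r, m) (Join s t' r, m')"
| step_join: "step P (Join (Thread d Halt) (Thread e Halt) r, m) (Thread (max d e + 1) r, m)"

primrec exec_span :: "('l, 'v, 'c) state \<Rightarrow> nat" where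
  "exec_span (Thread d p) = d"
| "exec_span (Join s t r) = max (exec_span s) (exec_span t)"

definition halted :: "('l, 'v, 'c) state \<Rightarrow> bool" where
  "halted s \<longleftrightarrow> (\<exists>d. s = Thread d Halt)"


section \<open>The algorithm\<close>

text \<open>
  \<open>Input i\<close> and \<open>Rank i\<close> belong to the object \<open>A ! i\<close>. With \<open>N\<close> leaves, the tournament tree
  occupies \<open>Tree 1, \<dots>, Tree (2 * N - 1)\<close>: the root is node \<open>1\<close>, the children of node \<open>v\<close> are
  \<open>2 * v\<close> and \<open>2 * v + 1\<close>, and the leaf of \<open>A ! i\<close> is \<open>N + i\<close>. \<open>Round\<close> holds \<open>r\<close>.
\<close>

datatype loc = Input nat | Tree nat | Rank nat | Round

datatype 'a word = Key (key: "'a extended") | Num (num: nat)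

datatype 'a name =
    Main nat
  | Build nat nat
  | Rounds nat
  | PrefixMin nat nat "'a extended"

type_synonym 'a lis_prog = "(loc, 'a word, 'a name) prog"

text \<open>
  The value \<open>+\<infinity>\<close> of a subtree without remaining objects counts as exceeding every bound, also the
  bound \<open>+\<infinity>\<close>. With the strict order of the extended values instead, an exhausted subtree on
  the left border of the tree would be entered again (its bound is the initial \<open>+\<infinity>\<close>), and the
  ranks stored there would be overwritten.
\<close>

definition exceeds :: "'a::linorder extended \<Rightarrow> 'a extended \<Rightarrow> bool" where
  "exceeds x b \<longleftrightarrow> x = Pinf \<or> b < x"

definition update_min :: "nat \<Rightarrow> 'a::linorder lis_prog" where
  "update_min v =
     Read (Tree (2 * v)) (\<lambda>x. Read (Tree (2 * v + 1)) (\<lambda>y.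
       Local (Write (Tree v) (Key (min (key x) (key y))) Halt)))"

text \<open>
  The program for inputs of length \<open>n\<close>; its entry point is \<open>Main 1\<close>. \<open>Main\<close> doubles its argument
  until it reaches the number \<open>N\<close> of leaves, which is then passed on to all other procedures.
\<close>

fun lis_procs :: "nat \<Rightarrow> 'a::linorder name \<Rightarrow> 'a lis_prog" where
  "lis_procs n (Main N) =
     Local (if N < n then Local (Call (Main (2 * N)) Halt)
            else Call (Build N 1) (Write Round (Num 0) (Call (Rounds N) Halt)))"
| "lis_procs n (Build N v) =
     Local (if N \<le> v then
              Local (if v - N < n
                     then Read (Input (v - N)) (\<lambda>x. Write (Tree v) x Halt)
                     else Write (Tree v) (Key Pinf) Halt)
            else Fork (Call (Build N (2 * v)) Halt) (Call (Build N (2 * v + 1)) Halt)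
                   (update_min v))"
| "lis_procs n (Rounds N) =
     Read (Tree 1) (\<lambda>x. Local (if key x = Pinf then Halt
       else Read Round (\<lambda>r. Local (Write Round (Num (num r + 1))
              (Call (PrefixMin N 1 Pinf) (Call (Rounds N) Halt))))))"
| "lis_procs n (PrefixMin N v lmin) =
     Read (Tree v) (\<lambda>x. Local (if exceeds (key x) lmin then Halt
       else Local (if N \<le> v then
              Read Round (\<lambda>r. Write (Rank (v - N)) (Num (num r))
                (Write (Tree v) (Key Pinf) Halt))
            else Read (Tree (2 * v)) (\<lambda>y. Local (
                   Fork (Call (PrefixMin N (2 * v) lmin) Halt)
                        (Call (PrefixMin N (2 * v + 1) (min lmin (key y))) Halt)
                     (update_min v))))))"

definition lis_start :: "(loc, 'a::linorder word, 'a name) state" where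
  "lis_start = Thread 0 (Call (Main 1) Halt)"

end

theory Submission
  imports Defs "HOL-Library.Disjoint_Sets"
begin

text \<open>
  In round \<open>r\<close> the remaining objects are those of rank at least \<open>r\<close>, and their prefix minima are
  exactly the objects of rank \<open>r\<close>: an object of larger rank has a smaller object of rank at least
  \<open>r\<close> before it. A node is entered in a round iff one of its leaves is extracted, so over all \<open>k\<close>
  rounds a node with \<open>2 ^ j\<close> leaves is entered at most \<open>min k (2 ^ j)\<close> times. Summed over the
  tree this gives \<open>O(n)\<close> for the levels above height \<open>log k\<close>, and \<open>O(n)\<close> for each of the
  \<open>log k\<close> levels below.

  Sibling threads of the program never touch a location that the other one writes. Hence all
  interleavings agree, and an execution can be replaced by a big-step derivation that carries its
  work and span.
\<close>

section \<open>A big-step semantics with footprints\<close>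

text \<open>
  In \<open>exec P R W p m m' w d\<close>, the program \<open>p\<close> reads only in \<open>R\<close> and writes only in \<open>W\<close>; \<open>w\<close> is its
  work and \<open>d\<close> its span.
\<close>

inductive exec ::
  "('c \<Rightarrow> ('l, 'v, 'c) prog) \<Rightarrow> 'l set \<Rightarrow> 'l set \<Rightarrow> ('l, 'v, 'c) prog \<Rightarrow>
   ('l \<Rightarrow> 'v) \<Rightarrow> ('l \<Rightarrow> 'v) \<Rightarrow> nat \<Rightarrow> nat \<Rightarrow> bool"
  for P where
  exec_halt: "exec P R W Halt m m 0 0"
| exec_local: "exec P R W p m m' w d \<Longrightarrow> exec P R W (Local p) m m' (Suc w) (Suc d)"
| exec_read: "l \<in> R \<Longrightarrow> exec P R W (f (m l)) m m' w d \<Longrightarrow>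
    exec P R W (Read l f) m m' (Suc w) (Suc d)"
| exec_write: "l \<in> W \<Longrightarrow> exec P R W p (m(l := v)) m' w d \<Longrightarrow>
    exec P R W (Write l v p) m m' (Suc w) (Suc d)"
| exec_call: "exec P R W (P c) m m1 w1 d1 \<Longrightarrow> exec P R W p m1 m' w2 d2 \<Longrightarrow>
    exec P R W (Call c p) m m' (Suc (w1 + w2)) (Suc (d1 + d2))"
| exec_fork: "exec P R1 W1 p m m1 w1 d1 \<Longrightarrow> exec P R2 W2 q m m2 w2 d2 \<Longrightarrow>
    R1 \<union> R2 \<subseteq> R \<Longrightarrow> W1 \<union> W2 \<subseteq> W \<Longrightarrow> W1 \<inter> (R2 \<union> W2) = {} \<Longrightarrow> W2 \<inter> R1 = {} \<Longrightarrow>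
    exec P R W r (override_on m1 m2 W2) m' w3 d3 \<Longrightarrow>
    exec P R W (Fork p q r) m m' (w1 + w2 + w3 + 2) (max d1 d2 + d3 + 2)"

lemma exec_unchanged:
  "exec P R W p m m' w d \<Longrightarrow> l \<notin> W \<Longrightarrow> m' l = m l"
  by (induction rule: exec.induct) (auto simp: override_on_def subset_iff)

lemma exec_mono:
  "exec P R W p m m' w d \<Longrightarrow> R \<subseteq> R' \<Longrightarrow> W \<subseteq> W' \<Longrightarrow> exec P R' W' p m m' w d"
proof (induction arbitrary: R' W' rule: exec.induct)
  case (exec_fork R1 W1 p m m1 w1 d1 R2 W2 q m2 w2 d2 R W r m' w3 d3)
  show ?case
    by (rule exec.exec_fork[OF exec_fork.hyps(1,2)]) (use exec_fork in auto)
qed (blast intro: exec.intros)+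

text \<open>A run sees only the cells of its footprint, so changing other cells of the initial
  memory changes the outcome only there, at the same cost. This is what lets a derivation survive
  the steps of a sibling thread.\<close>

lemma exec_frame:
  "exec P R W p m m' w d \<Longrightarrow> (\<forall>l\<in>R \<union> W. n l = m l) \<Longrightarrow>
   exec P R W p n (override_on n m' W) w d"
proof (induction arbitrary: n rule: exec.induct)
  case (exec_halt R W m)
  then have "override_on n m W = n" by (auto simp: override_on_def)
  then show ?case by (simp add: exec.exec_halt)
next
  case (exec_local R W p m m' w d)
  then show ?case by (auto intro: exec.intros)
next
  case (exec_read l R f m W m' w d)
  then show ?case by (auto intro: exec.intros)
next
  case (exec_write l W R p m v m' w d)
  then have "exec P R W p (n(l := v)) (override_on (n(l := v)) m' W) w d" by simp
  moreover have "override_on (n(l := v)) m' W = override_on n m' W"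
    using exec_write.hyps by (auto simp: override_on_def)
  ultimately show ?case using exec_write.hyps by (auto intro: exec.intros)
next
  case (exec_call R W c m m1 w1 d1 p m' w2 d2)
  have "exec P R W p (override_on n m1 W) (override_on (override_on n m1 W) m' W) w2 d2"
    using exec_call.prems exec_unchanged[OF exec_call.hyps(1)]
    by (intro exec_call.IH) (auto simp: override_on_def)
  moreover have "override_on (override_on n m1 W) m' W = override_on n m' W"
    by (auto simp: override_on_def)
  ultimately show ?case using exec_call by (auto intro: exec.intros)
next
  case (exec_fork R1 W1 p m m1 w1 d1 R2 W2 q m2 w2 d2 R W r m' w3 d3)
  let ?n = "override_on (override_on n m1 W1) (override_on n m2 W2) W2"
  have 1: "exec P R1 W1 p n (override_on n m1 W1) w1 d1"
    and 2: "exec P R2 W2 q n (override_on n m2 W2) w2 d2"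
    using exec_fork.prems exec_fork.hyps(3,4)
    by (blast intro: exec_fork.IH)+
  have "exec P R W r ?n (override_on ?n m' W) w3 d3"
    using exec_fork.prems exec_unchanged[OF exec_fork.hyps(1)]
    by (intro exec_fork.IH) (auto simp: override_on_def)
  moreover have "override_on ?n m' W = override_on n m' W"
    using exec_fork.hyps(4) by (intro ext) (auto simp: override_on_def)
  ultimately show ?case
    using exec.exec_fork[OF 1 2] exec_fork.hyps by simp
qed

text \<open>A small-step call splices the body in front of the continuation with \<open>seq\<close>,
  whereas \<open>exec_call\<close> keeps the two runs apart; this lemma mediates at no extra
  cost.\<close>

lemma exec_seq:
  "exec P R W p m m1 w1 d1 \<Longrightarrow> exec P R W k m1 m' w2 d2 \<Longrightarrow>
   exec P R W (seq p k) m m' (w1 + w2) (d1 + d2)"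
proof (induction rule: exec.induct)
  case (exec_call R W c m m1 w1 d1 p m'' w2' d2')
  then show ?case
    using exec.exec_call[of P R W c m m1 w1 d1 "seq p k" m' "w2' + w2" "d2' + d2"]
    by (simp add: add.assoc)
next
  case (exec_fork R1 W1 p m m1 w1 d1 R2 W2 q m2 w2' d2' R W r m'' w3 d3)
  then have "exec P R W (Fork p q (seq r k)) m m' (w1 + w2' + (w3 + w2) + 2)
      (max d1 d2' + (d3 + d2) + 2)"
    using exec.exec_fork[of P R1 W1 p m m1 w1 d1 R2 W2 q m2 w2' d2' R W "seq r k" m'
      "w3 + w2" "d3 + d2"] by simp
  then show ?case by (simp add: algebra_simps)
qed (auto intro: exec.intros)

section \<open>Partially executed states and soundness of the big-step costs\<close>

text \<open>The invariant of an execution. Here \<open>w\<close> is the work still to be done, while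
  \<open>d\<close> is the span of the whole execution, since the depth \<open>e\<close> already
  reached is included. The join costs 1 and not 2 because the fork has been paid for.\<close>

inductive exec_state ::
  "('c \<Rightarrow> ('l, 'v, 'c) prog) \<Rightarrow> 'l set \<Rightarrow> 'l set \<Rightarrow> ('l, 'v, 'c) state \<Rightarrow>
   ('l \<Rightarrow> 'v) \<Rightarrow> ('l \<Rightarrow> 'v) \<Rightarrow> nat \<Rightarrow> nat \<Rightarrow> bool"
  for P where
  exec_thread: "exec P R W p m m' w d \<Longrightarrow> exec_state P R W (Thread e p) m m' w (e + d)"
| exec_join: "exec_state P R1 W1 s m m1 w1 d1 \<Longrightarrow> exec_state P R2 W2 t m m2 w2 d2 \<Longrightarrow>
    R1 \<union> R2 \<subseteq> R \<Longrightarrow> W1 \<union> W2 \<subseteq> W \<Longrightarrow> W1 \<inter> (R2 \<union> W2) = {} \<Longrightarrow> W2 \<inter> R1 = {} \<Longrightarrow>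
    exec P R W r (override_on m1 m2 W2) m' w3 d3 \<Longrightarrow>
    exec_state P R W (Join s t r) m m' (w1 + w2 + w3 + 1) (max d1 d2 + d3 + 1)"

inductive_cases exec_cases:
  "exec P R W Halt m m' w d"
  "exec P R W (Local p) m m' w d"
  "exec P R W (Read l f) m m' w d"
  "exec P R W (Write l v p) m m' w d"
  "exec P R W (Call c p) m m' w d"
  "exec P R W (Fork p q r) m m' w d"

inductive_cases exec_state_cases:
  "exec_state P R W (Thread e p) m m' w d"
  "exec_state P R W (Join s t r) m m' w d"

lemma exec_state_unchanged:
  "exec_state P R W s m m' w d \<Longrightarrow> l \<notin> W \<Longrightarrow> m' l = m l"
proof (induction rule: exec_state.induct)
  case (exec_join R1 W1 s m m1 w1 d1 R2 W2 t m2 w2 d2 R W r m' w3 d3)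
  then show ?case
    using exec_unchanged[OF exec_join.hyps(7)] by (auto simp: override_on_def subset_iff)
qed (rule exec_unchanged)

lemma exec_state_frame:
  "exec_state P R W s m m' w d \<Longrightarrow> (\<forall>l\<in>R \<union> W. n l = m l) \<Longrightarrow>
   exec_state P R W s n (override_on n m' W) w d"
proof (induction arbitrary: n rule: exec_state.induct)
  case (exec_thread R W p m m' w d e)
  then show ?case by (auto intro: exec_state.intros exec_frame)
next
  case (exec_join R1 W1 s m m1 w1 d1 R2 W2 t m2 w2 d2 R W r m' w3 d3)
  let ?n = "override_on (override_on n m1 W1) (override_on n m2 W2) W2"
  have 1: "exec_state P R1 W1 s n (override_on n m1 W1) w1 d1"
    and 2: "exec_state P R2 W2 t n (override_on n m2 W2) w2 d2"
    using exec_join.prems exec_join.hyps(3,4)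
    by (blast intro: exec_join.IH)+
  have "exec P R W r ?n (override_on ?n m' W) w3 d3"
    using exec_join.prems exec_state_unchanged[OF exec_join.hyps(1)]
    by (intro exec_frame[OF exec_join.hyps(7)]) (auto simp: override_on_def)
  moreover have "override_on ?n m' W = override_on n m' W"
    using exec_join.hyps(4) by (intro ext) (auto simp: override_on_def)
  ultimately show ?case
    using exec_state.exec_join[OF 1 2] exec_join.hyps by simp
qed

lemma exec_state_span: "exec_state P R W s m m' w d \<Longrightarrow> exec_span s \<le> d"
  by (induction rule: exec_state.induct) auto

lemma exec_state_done:
  "exec_state P R W s m m' w d \<Longrightarrow> w = 0 \<Longrightarrow> halted s \<and> m' = m"
  by (induction rule: exec_state.induct) (auto simp: halted_def elim: exec.cases)

text \<open>At a join, a child with remaining work can move; if neither has any, both have halted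
  and the join itself is enabled.\<close>

lemma exec_state_progress:
  "exec_state P R W s m m' w d \<Longrightarrow> w \<noteq> 0 \<Longrightarrow> \<exists>t. step P (s, m) t"
proof (induction rule: exec_state.induct)
  case (exec_thread R W p m m' w d e)
  then show ?case by (cases p) (auto elim: exec_cases intro: step.intros)
next
  case (exec_join R1 W1 s m m1 w1 d1 R2 W2 t m2 w2 d2 R W r m' w3 d3)
  consider "w1 \<noteq> 0" | "w2 \<noteq> 0" | "w1 = 0" "w2 = 0" by blast
  then show ?case
  proof cases
    case 3
    then obtain d e where "s = Thread d Halt" "t = Thread e Halt"
      using exec_state_done exec_join.hyps(1,2) unfolding halted_def by metis
    then show ?thesis by (auto intro: step.intros)
  next
    case 1
    then obtain s' m' where "step P (s, m) (s', m')" using exec_join.IH(1) by auto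
    then show ?thesis by (blast intro: step_left)
  next
    case 2
    then obtain t' m' where "step P (t, m) (t', m')" using exec_join.IH(2) by auto
    then show ?thesis by (blast intro: step_right)
  qed
qed

text \<open>Siblings do not conflict, so a step of one leaves every cell that the other reads or
  writes unchanged. The clause on cells outside \<open>W\<close> is carried along to make this
  available under a join.\<close>

lemma exec_state_step:
  "step P (s, m) (s2, m2) \<Longrightarrow> exec_state P R W s m m' w d \<Longrightarrow>
   \<exists>w'. w = Suc w' \<and> exec_state P R W s2 m2 m' w' d \<and> (\<forall>l. l \<notin> W \<longrightarrow> m2 l = m l)"
proof (induction "(s, m)" "(s2, m2)" arbitrary: s m s2 m2 m' R W w d rule: step.induct)
  case (step_local e p m)
  from step_local[THEN exec_state_cases(1)] obtain d' where
    d: "d = e + d'" and "exec P R W (Local p) m m' w d'" by blast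
  from this(2) show ?case
    by (elim exec_cases(2)) (use exec_thread[of P R W _ _ m' _ _ "e + 1"] d in force)
next
  case (step_read e l f m)
  from step_read[THEN exec_state_cases(1)] obtain d' where
    d: "d = e + d'" and "exec P R W (Read l f) m m' w d'" by blast
  from this(2) show ?case
    by (elim exec_cases(3)) (use exec_thread[of P R W _ _ m' _ _ "e + 1"] d in force)
next
  case (step_write e l v p m)
  from step_write[THEN exec_state_cases(1)] obtain d' where
    d: "d = e + d'" and "exec P R W (Write l v p) m m' w d'" by blast
  from this(2) show ?case
    by (elim exec_cases(4)) (use exec_thread[of P R W _ _ m' _ _ "e + 1"] d in force)
next
  case (step_call e c p m)
  from step_call[THEN exec_state_cases(1)] obtain d' where
    d: "d = e + d'" and "exec P R W (Call c p) m m' w d'" by blast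
  from this(2) show ?case
    by (elim exec_cases(5)) (use exec_thread[OF exec_seq, of P R W "P c" m _ _ _ p m' _ _ "e + 1"] d in \<open>auto simp: add.assoc\<close>)
next
  case (step_fork e p q r m)
  from step_fork[THEN exec_state_cases(1)] obtain d' where
    d: "d = e + d'" and ex: "exec P R W (Fork p q r) m m' w d'" by blast
  from ex show ?case
  proof (rule exec_cases(6))
    fix R1 W1 m1 w1 d1 R2 W2 m2 w2 d2 w3 d3
    assume 1: "w = Suc (Suc (w1 + w2 + w3))" "d' = Suc (Suc (max d1 d2 + d3))"
      "exec P R1 W1 p m m1 w1 d1" "exec P R2 W2 q m m2 w2 d2"
      "W1 \<inter> (R2 \<union> W2) = {}" "W2 \<inter> R1 = {}"
      "exec P R W r (override_on m1 m2 W2) m' w3 d3"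
      "R1 \<subseteq> R" "R2 \<subseteq> R" "W1 \<subseteq> W" "W2 \<subseteq> W"
    have "exec_state P R W (Join (Thread (e + 1) p) (Thread (e + 1) q) r) m m'
        (w1 + w2 + w3 + 1) (max (e + 1 + d1) (e + 1 + d2) + d3 + 1)"
      by (rule exec_join[OF exec_thread exec_thread]) (use 1 in auto)
    then show ?thesis using 1 d by (auto simp: max_def add.assoc)
  qed
next
  case (step_left s m s' n t r)
  from step_left.prems show ?case
  proof (rule exec_state_cases(2))
    fix R1 W1 m1 w1 d1 R2 W2 m2 w2 d2 w3 d3
    assume 1: "w = Suc (w1 + w2 + w3)" "d = Suc (max d1 d2 + d3)"
      "exec_state P R1 W1 s m m1 w1 d1" "exec_state P R2 W2 t m m2 w2 d2"
      "W1 \<inter> (R2 \<union> W2) = {}" "W2 \<inter> R1 = {}"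
      "exec P R W r (override_on m1 m2 W2) m' w3 d3"
      "R1 \<subseteq> R" "R2 \<subseteq> R" "W1 \<subseteq> W" "W2 \<subseteq> W"
    from step_left.hyps(2)[OF 1(3)] obtain w' where
      w': "w1 = Suc w'" "exec_state P R1 W1 s' n m1 w' d1" and n: "\<forall>l. l \<notin> W1 \<longrightarrow> n l = m l"
      by blast
    \<comment> \<open>The sibling now ends in \<open>override_on n m2 W2\<close>; the merge at the
      join takes only the cells in \<open>W2\<close> from it.\<close>
    have t: "exec_state P R2 W2 t n (override_on n m2 W2) w2 d2"
      using n 1 by (intro exec_state_frame[OF 1(4)]) auto
    have "override_on m1 (override_on n m2 W2) W2 = override_on m1 m2 W2"
      by (auto simp: override_on_def)
    then have "exec_state P R W (Join s' t r) n m' (w' + w2 + w3 + 1) (max d1 d2 + d3 + 1)"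
      using 1 by (intro exec_join[OF w'(2) t]) auto
    then show ?thesis using w' n 1 by auto
  qed
next
  case (step_right t m t' n s r)
  from step_right.prems show ?case
  proof (rule exec_state_cases(2))
    fix R1 W1 m1 w1 d1 R2 W2 m2 w2 d2 w3 d3
    assume 1: "w = Suc (w1 + w2 + w3)" "d = Suc (max d1 d2 + d3)"
      "exec_state P R1 W1 s m m1 w1 d1" "exec_state P R2 W2 t m m2 w2 d2"
      "W1 \<inter> (R2 \<union> W2) = {}" "W2 \<inter> R1 = {}"
      "exec P R W r (override_on m1 m2 W2) m' w3 d3"
      "R1 \<subseteq> R" "R2 \<subseteq> R" "W1 \<subseteq> W" "W2 \<subseteq> W"
    from step_right.hyps(2)[OF 1(4)] obtain w' where
      w': "w2 = Suc w'" "exec_state P R2 W2 t' n m2 w' d2" and n: "\<forall>l. l \<notin> W2 \<longrightarrow> n l = m l"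
      by blast
    have s: "exec_state P R1 W1 s n (override_on n m1 W1) w1 d1"
      using n 1 by (intro exec_state_frame[OF 1(3)]) auto
    \<comment> \<open>Outside \<open>W1\<close> and \<open>W2\<close> neither thread writes, so
      \<open>n\<close>, \<open>m\<close> and \<open>m1\<close> agree there.\<close>
    have "override_on (override_on n m1 W1) m2 W2 = override_on m1 m2 W2"
      using n exec_state_unchanged[OF 1(3)] by (auto simp: override_on_def)
    then have "exec_state P R W (Join s t' r) n m' (w1 + w' + w3 + 1) (max d1 d2 + d3 + 1)"
      using 1 by (intro exec_join[OF s w'(2)]) auto
    then show ?thesis using w' n 1 by auto
  qed
next
  case (step_join a b r m)
  from step_join.prems show ?case
  proof (rule exec_state_cases(2))
    fix R1 W1 m1 w1 d1 R2 W2 m2 w2 d2 w3 d3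
    assume 1: "w = Suc (w1 + w2 + w3)" "d = Suc (max d1 d2 + d3)"
      "exec_state P R1 W1 (Thread a Halt) m m1 w1 d1" "exec_state P R2 W2 (Thread b Halt) m m2 w2 d2"
      "W1 \<inter> (R2 \<union> W2) = {}" "W2 \<inter> R1 = {}"
      "exec P R W r (override_on m1 m2 W2) m' w3 d3"
      "R1 \<subseteq> R" "R2 \<subseteq> R" "W1 \<subseteq> W" "W2 \<subseteq> W"
    have "w1 = 0" "d1 = a" "m1 = m" "w2 = 0" "d2 = b" "m2 = m"
      using 1(3,4) by (auto elim!: exec_state_cases exec_cases)
    then show ?thesis using 1 exec_thread[of P R W r m m' w3 d3 "max a b + 1"]
      by (auto simp: override_on_def)
  qed
qed

lemma exec_state_steps:
  "(step P ^^ k) (s, m) (s2, m2) \<Longrightarrow> exec_state P R W s m m' w d \<Longrightarrow>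
   \<exists>w'. w = k + w' \<and> exec_state P R W s2 m2 m' w' d"
proof (induction k arbitrary: s2 m2)
  case (Suc k)
  then obtain s1 m1 where 1: "(step P ^^ k) (s, m) (s1, m1)" "step P (s1, m1) (s2, m2)"
    by (auto elim: relpowp_Suc_E)
  with Suc exec_state_step[OF 1(2)] show ?case by fastforce
qed auto

text \<open>One derivation bounds every interleaving: after \<open>k\<close> steps the remaining
  work \<open>w'\<close> satisfies \<open>w = k + w'\<close>, and a state that cannot step has
  \<open>w' = 0\<close> by progress.\<close>

theorem exec_sound:
  assumes "exec P UNIV UNIV p m m' w d" "(step P ^^ k) (Thread 0 p, m) (s, m2)"
  shows "k \<le> w" "exec_span s \<le> d" "(\<nexists>t. step P (s, m2) t) \<Longrightarrow> halted s \<and> m2 = m'"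
proof -
  obtain w' where "w = k + w'" and ex: "exec_state P UNIV UNIV s m2 m' w' (0 + d)"
    using exec_state_steps[OF assms(2) exec_thread[OF assms(1)]] by blast
  then show "k \<le> w" "exec_span s \<le> d" using exec_state_span[OF ex] by auto
  show "halted s \<and> m2 = m'" if "\<nexists>t. step P (s, m2) t"
    using that exec_state_progress[OF ex] exec_state_done[OF ex] by blast
qed

section \<open>Ranks and prefix minima\<close>

lemma lis_rank_attained:
  obtains I where "I \<subseteq> {..i}" "i \<in> I" "strict_mono_on I (\<lambda>j. A ! j)" "card I = lis_rank A i"
proof -
  let ?C = "{card I |I. I \<subseteq> {..i} \<and> i \<in> I \<and> strict_mono_on I (\<lambda>j. A ! j)}"
  have "finite ?C" by (rule finite_subset[of _ "card ` Pow {..i}"]) auto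
  moreover have "?C \<noteq> {}" by (auto simp: strict_mono_on_def intro!: exI[of _ "{i}"])
  ultimately have "lis_rank A i \<in> ?C" unfolding lis_rank_def by (rule Max_in)
  then show ?thesis using that by auto
qed

lemma card_le_lis_rank:
  assumes "I \<subseteq> {..i}" "i \<in> I" "strict_mono_on I (\<lambda>j. A ! j)"
  shows "card I \<le> lis_rank A i"
  unfolding lis_rank_def
  by (rule Max_ge) (use assms in \<open>auto intro: finite_subset[of _ "card ` Pow {..i}"]\<close>)

lemma lis_rank_pos: "0 < lis_rank A i"
  using card_le_lis_rank[of "{i}" i A] by (auto simp: strict_mono_on_def)

text \<open>A longest subsequence ending at \<open>j\<close> can be extended by \<open>i\<close>,
  because every value in it is at most \<open>A ! j\<close>.\<close>

lemma lis_rank_less: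
  assumes "j < i" "A ! j < A ! i"
  shows "lis_rank A j < lis_rank A i"
proof -
  obtain I where I: "I \<subseteq> {..j}" "j \<in> I" "strict_mono_on I (\<lambda>j. A ! j)" "card I = lis_rank A j"
    by (rule lis_rank_attained)
  have "A ! r < A ! i" if "r \<in> I" for r
  proof (cases "r = j")
    case False
    then have "r < j" using I(1) that by (auto simp: order_le_less)
    then show ?thesis using I assms(2) that by (auto simp: strict_mono_on_def intro: less_trans)
  qed (use assms in auto)
  then have "strict_mono_on (insert i I) (\<lambda>j. A ! j)"
    using I(1,3) assms(1) unfolding strict_mono_on_def
    by (metis atMost_iff insert_iff not_less_iff_gr_or_eq order.strict_trans1 subsetD)
  then have "card (insert i I) \<le> lis_rank A i"
    using I assms(1) by (intro card_le_lis_rank) auto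
  moreover have "i \<notin> I" "finite I" using I assms(1) finite_subset by auto
  ultimately show ?thesis using I(4) by simp
qed

text \<open>The second to last position of a longest subsequence ending at \<open>i\<close> serves
  as \<open>j\<close>: what precedes \<open>i\<close> in it is a subsequence ending at
  \<open>j\<close>.\<close>

lemma lis_rank_predecessor:
  assumes "1 < lis_rank A i"
  obtains j where "j < i" "A ! j < A ! i" "lis_rank A i \<le> Suc (lis_rank A j)"
proof -
  obtain I where I: "I \<subseteq> {..i}" "i \<in> I" "strict_mono_on I (\<lambda>j. A ! j)" "card I = lis_rank A i"
    by (rule lis_rank_attained)
  have fin: "finite I" using I(1) finite_subset by auto
  define J where "J = I - {i}"
  have card: "Suc (card J) = lis_rank A i"
    using I fin card_Suc_Diff1 unfolding J_def by metis
  then have ne: "J \<noteq> {}" using assms by auto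
  define j where "j = Max J"
  have "finite J" using fin by (simp add: J_def)
  then have j: "j \<in> J" "J \<subseteq> {..j}" using ne unfolding j_def by auto
  have "j \<in> I" "j < i" using I(1) j(1) by (auto simp: J_def order_le_less)
  moreover have "A ! j < A ! i" using I calculation by (auto simp: strict_mono_on_def)
  moreover have "card J \<le> lis_rank A j"
    by (rule card_le_lis_rank) (use I j in \<open>auto simp: J_def strict_mono_on_def\<close>)
  ultimately show ?thesis using that card by auto
qed

text \<open>An earlier smaller object of rank above \<open>r\<close> would push the rank of
  \<open>i\<close> above \<open>Suc r\<close>; conversely a rank above \<open>Suc r\<close> has such
  an object as its predecessor. This turns the rank into a condition on the objects still present
  after \<open>r\<close> rounds.\<close>

lemma lis_rank_eq_Suc_iff:
  assumes "r < lis_rank A i"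
  shows "lis_rank A i = Suc r \<longleftrightarrow> (\<forall>j<i. r < lis_rank A j \<longrightarrow> A ! i \<le> A ! j)"
proof
  assume "lis_rank A i = Suc r"
  then show "\<forall>j<i. r < lis_rank A j \<longrightarrow> A ! i \<le> A ! j"
    using lis_rank_less[of _ i A] by (metis less_antisym not_less not_less_iff_gr_or_eq)
next
  assume *: "\<forall>j<i. r < lis_rank A j \<longrightarrow> A ! i \<le> A ! j"
  show "lis_rank A i = Suc r"
  proof (rule ccontr)
    assume "lis_rank A i \<noteq> Suc r"
    then have gt: "Suc r < lis_rank A i" using assms by simp
    then obtain j where "j < i" "A ! j < A ! i" "lis_rank A i \<le> Suc (lis_rank A j)"
      using lis_rank_predecessor[of A i] by auto
    then show False using * gt by (meson Suc_lessD Suc_less_eq leD less_le_trans)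
  qed
qed

lemma lis_length_bounds:
  assumes "A \<noteq> []"
  shows "lis_length A \<le> length A" "0 < lis_length A"
    and "i < length A \<Longrightarrow> lis_rank A i \<le> lis_length A"
    and "\<exists>i<length A. lis_rank A i = lis_length A"
proof -
  let ?R = "lis_rank A ` {..<length A}"
  have ne: "finite ?R" "?R \<noteq> {}" using assms by auto
  show "i < length A \<Longrightarrow> lis_rank A i \<le> lis_length A"
    unfolding lis_length_def by (rule Max_ge) auto
  have "lis_length A \<in> ?R" unfolding lis_length_def using ne by (rule Max_in)
  then show ex: "\<exists>i<length A. lis_rank A i = lis_length A" by auto
  then show "0 < lis_length A" using lis_rank_pos[of A] by metis
  from ex obtain i where i: "i < length A" "lis_rank A i = lis_length A" by auto
  obtain I where I: "I \<subseteq> {..i}" "card I = lis_rank A i"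
    by (rule lis_rank_attained)
  then show "lis_length A \<le> length A"
    using card_mono[OF _ I(1)] i by auto
qed

section \<open>Prefix minima under a bound\<close>

text \<open>The positions that a call of \<open>PrefixMin\<close> on the leaves \<open>U\<close>
  with bound \<open>b\<close> has to extract. Equal keys do not block each other, in keeping with
  strictly increasing subsequences.\<close>

definition prefix_minima ::
  "(nat \<Rightarrow> 'a::linorder extended) \<Rightarrow> nat set \<Rightarrow> 'a extended \<Rightarrow> nat set" where
  "prefix_minima x U b =
     {u \<in> U. \<not> exceeds (x u) b \<and> (\<forall>u'\<in>U. u' < u \<longrightarrow> x u \<le> x u')}"

lemma prefix_minima_subset: "prefix_minima x U b \<subseteq> U"
  by (auto simp: prefix_minima_def)

text \<open>A position attaining the minimum can be kept out only by the bound, so the value at a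
  node alone decides whether anything below it is extracted. This justifies the early
  return.\<close>

lemma prefix_minima_empty_iff:
  assumes "finite U" "U \<noteq> {}"
  shows "prefix_minima x U b = {} \<longleftrightarrow> exceeds (Min (x ` U)) b"
proof
  assume ex: "exceeds (Min (x ` U)) b"
  have "exceeds (x u) b" if "u \<in> U" for u
  proof -
    have "Min (x ` U) \<le> x u" using assms that by simp
    with ex show ?thesis unfolding exceeds_def by (cases "Min (x ` U) = Pinf") auto
  qed
  then show "prefix_minima x U b = {}" by (auto simp: prefix_minima_def)
next
  assume empty: "prefix_minima x U b = {}"
  define V where "V = {u \<in> U. x u = Min (x ` U)}"
  have "Min (x ` U) \<in> x ` U" using assms by simp
  then obtain u where "u \<in> U" "x u = Min (x ` U)" by (metis imageE)
  then have V: "finite V" "V \<noteq> {}" using assms(1) unfolding V_def by auto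
  then have "Min V \<in> V" by (rule Min_in)
  then have "Min V \<in> U" "x (Min V) = Min (x ` U)" by (auto simp: V_def)
  moreover have "\<forall>u'\<in>U. Min (x ` U) \<le> x u'" using assms by simp
  ultimately have "Min V \<in> prefix_minima x U b" if "\<not> exceeds (Min (x ` U)) b"
    using that by (simp add: prefix_minima_def)
  then show "exceeds (Min (x ` U)) b" using empty by blast
qed

text \<open>Correctness of the recursion into two children: for a position on the right, having no
  smaller value in \<open>U\<close> means being at most the minimum over \<open>U\<close>, and this
  condition is merged into the bound.\<close>

lemma prefix_minima_Un:
  assumes "finite U" "U \<noteq> {}" "\<forall>u\<in>U. \<forall>v\<in>V. u < v"
  shows "prefix_minima x (U \<union> V) b =
    prefix_minima x U b \<union> prefix_minima x V (min b (Min (x ` U)))"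
proof -
  have V: "v \<notin> U" "\<forall>u\<in>U. u < v" if "v \<in> V" for v using assms(3) that by auto
  have U: "\<not> v < u" if "u \<in> U" "v \<in> V" for u v using assms(3) that by fastforce
  have Min: "y \<le> Min (x ` U) \<longleftrightarrow> (\<forall>u\<in>U. y \<le> x u)" for y using assms by simp
  have "u \<in> prefix_minima x (U \<union> V) b \<longleftrightarrow> u \<in> prefix_minima x U b" if "u \<in> U" for u
    using U[OF that] that by (auto simp: prefix_minima_def)
  moreover have "u \<in> prefix_minima x (U \<union> V) b \<longleftrightarrow>
      u \<in> prefix_minima x V (min b (Min (x ` U)))" if "u \<in> V" for u
    using V[OF that] that by (auto simp: prefix_minima_def exceeds_def not_less Min)
  moreover have "prefix_minima x W c \<subseteq> W" for W c by (rule prefix_minima_subset)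
  ultimately show ?thesis using V(1) by blast
qed

text \<open>Objects and leaf values are indexed by the tree node \<open>N + i\<close> of \<open>A ! i\<close>.\<close>

definition remaining :: "'a::linorder list \<Rightarrow> nat \<Rightarrow> nat \<Rightarrow> nat \<Rightarrow> 'a extended" where
  "remaining A N r u =
     (if u - N < length A \<and> r < lis_rank A (u - N) then Fin (A ! (u - N)) else Pinf)"

definition layer :: "'a::linorder list \<Rightarrow> nat \<Rightarrow> nat \<Rightarrow> nat set" where
  "layer A N r = {u. N \<le> u \<and> u - N < length A \<and> lis_rank A (u - N) = Suc r}"

text \<open>This is \<open>lis_rank_eq_Suc_iff\<close> read off at the leaves: extracted objects and
  padding have the value \<open>Pinf\<close>, so they neither qualify nor block a later
  leaf.\<close>

lemma prefix_minima_remaining: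
  assumes "length A \<le> N"
  shows "prefix_minima (remaining A N r) {N..<2 * N} Pinf = layer A N r"
proof (intro set_eqI iffI)
  fix u assume u: "u \<in> layer A N r"
  then have "r < lis_rank A (u - N)" by (simp add: layer_def)
  from lis_rank_eq_Suc_iff[OF this]
  have le: "\<forall>j<u - N. r < lis_rank A j \<longrightarrow> A ! (u - N) \<le> A ! j"
    using u by (simp add: layer_def)
  have "remaining A N r u \<le> remaining A N r u'" if "N \<le> u'" "u' < u" for u'
    using u le that by (auto simp: remaining_def layer_def diff_less_mono)
  then show "u \<in> prefix_minima (remaining A N r) {N..<2 * N} Pinf"
    using u assms by (auto simp: prefix_minima_def layer_def remaining_def exceeds_def)
next
  fix u assume u: "u \<in> prefix_minima (remaining A N r) {N..<2 * N} Pinf"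
  then have 1: "N \<le> u" "u - N < length A" and 2: "r < lis_rank A (u - N)"
    by (auto simp: prefix_minima_def remaining_def exceeds_def split: if_splits)
  have "A ! (u - N) \<le> A ! j" if "j < u - N" "r < lis_rank A j" for j
  proof -
    have "remaining A N r u \<le> remaining A N r (N + j)"
      using u that(1) by (auto simp: prefix_minima_def)
    then show ?thesis using 1 2 that by (simp add: remaining_def)
  qed
  then show "u \<in> layer A N r"
    using 1 lis_rank_eq_Suc_iff[OF 2] by (simp add: layer_def)
qed

lemma remaining_Suc:
  assumes "N \<le> u"
  shows "remaining A N (Suc r) u = (if u \<in> layer A N r then Pinf else remaining A N r u)"
  using assms by (auto simp: remaining_def layer_def)

section \<open>Subtrees\<close>

text \<open>The descendants of node \<open>v\<close> that lie \<open>j\<close> levels below it in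
  the heap numbering. The explicit interval makes their order and number immediate.\<close>

definition leaves :: "nat \<Rightarrow> nat \<Rightarrow> nat set" where
  "leaves j v = {v * 2 ^ j..<(v + 1) * 2 ^ j}"

lemma leaves_0 [simp]: "leaves 0 v = {v}"
  by (auto simp: leaves_def)

lemma leaves_Suc: "leaves (Suc j) v = leaves j (2 * v) \<union> leaves j (2 * v + 1)"
  unfolding leaves_def by (auto simp: algebra_simps)

lemma leaves_less: "u \<in> leaves j (2 * v) \<Longrightarrow> u' \<in> leaves j (2 * v + 1) \<Longrightarrow> u < u'"
  by (auto simp: leaves_def)

lemma finite_leaves [simp]: "finite (leaves j v)"
  and leaves_nonempty [simp]: "leaves j v \<noteq> {}"
  and card_leaves [simp]: "card (leaves j v) = 2 ^ j"
  by (auto simp: leaves_def algebra_simps)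

primrec subtree :: "nat \<Rightarrow> nat \<Rightarrow> nat set" where
  "subtree 0 v = {v}"
| "subtree (Suc j) v = insert v (subtree j (2 * v) \<union> subtree j (2 * v + 1))"

text \<open>Halving an index gives the parent, so every node of the subtree reaches \<open>v\<close>
  after some number of halvings.\<close>

lemma subtree_div: "u \<in> subtree j v \<Longrightarrow> \<exists>i. u div 2 ^ i = v"
proof (induction j arbitrary: v)
  case 0
  then show ?case by (auto intro: exI[of _ 0])
next
  case (Suc j)
  then consider "u = v" | i where "u div 2 ^ i = 2 * v" | i where "u div 2 ^ i = 2 * v + 1"
    using Suc.IH[of "2 * v"] Suc.IH[of "2 * v + 1"] unfolding subtree.simps by blast
  then show ?case
  proof cases
    case 1
    then have "u div 2 ^ 0 = v" by simp
    then show ?thesis by (rule exI)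
  next
    case (2 i)
    then have "u div 2 ^ Suc i = v" by (simp only: power_Suc2 div_mult2_eq)
    then show ?thesis by (rule exI)
  next
    case (3 i)
    then have "u div 2 ^ Suc i = v" by (simp only: power_Suc2 div_mult2_eq)
    then show ?thesis by (rule exI)
  qed
qed

lemma subtree_ge: "u \<in> subtree j v \<Longrightarrow> v \<le> u"
  using subtree_div div_le_dividend by metis

text \<open>Both \<open>a\<close> and \<open>b\<close> are ancestors of \<open>u\<close>, and
  \<open>b\<close> arises from \<open>a\<close> by at least one further halving.\<close>

lemma div_power_less:
  assumes "u div 2 ^ i = a" "u div 2 ^ j = b" "i < j"
  shows "b \<le> a div (2::nat)"
proof -
  have "u div 2 ^ j = u div (2 ^ i * 2 ^ (j - i))"
    using assms(3) by (simp only: flip: power_add) simp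
  then have "b = a div 2 ^ (j - i)"
    using assms by (simp only: div_mult2_eq)
  also have "\<dots> \<le> a div 2 ^ 1"
    using assms(3) by (intro div_le_mono2 power_increasing) auto
  finally show ?thesis by simp
qed

text \<open>A common descendant would make one child an ancestor of the other, hence at most half of
  it, or make both equal. Node 0 would be its own left child, hence \<open>0 < v\<close>.\<close>

lemma subtree_children_disjoint:
  assumes "0 < v"
  shows "subtree j (2 * v) \<inter> subtree j (2 * v + 1) = {}"
proof -
  have False if u: "u \<in> subtree j (2 * v)" "u \<in> subtree j (2 * v + 1)" for u
  proof -
    obtain i i' where *: "u div 2 ^ i = 2 * v" "u div 2 ^ i' = 2 * v + 1"
      using subtree_div[OF u(1)] subtree_div[OF u(2)] by blast
    consider "i < i'" | "i' < i" | "i = i'" by linarith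
    then show False
    proof cases
      case 1
      then show ?thesis using div_power_less[OF *] by simp
    next
      case 2
      then show ?thesis using div_power_less[OF *(2,1)] assms by simp
    next
      case 3
      then show ?thesis using * by simp
    qed
  qed
  then show ?thesis by blast
qed

lemma subtree_children_not_mem:
  assumes "0 < v"
  shows "v \<notin> subtree j (2 * v)" "v \<notin> subtree j (2 * v + 1)"
  using subtree_ge[of v j "2 * v"] subtree_ge[of v j "2 * v + 1"] assms by linarith+

section \<open>Counting the nodes visited over all rounds\<close>

text \<open>The number of nodes of the subtree with a leaf in \<open>S\<close> below them or in
  \<open>S\<close> themselves. With \<open>S\<close> the extracted leaves, these are the nodes at
  which \<open>PrefixMin\<close> does not return at once.\<close>

fun touched :: "nat set \<Rightarrow> nat \<Rightarrow> nat \<Rightarrow> nat" where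
  "touched S 0 v = (if v \<in> S then 1 else 0)"
| "touched S (Suc j) v = (if S \<inter> leaves (Suc j) v = {} then 0
     else 1 + touched S j (2 * v) + touched S j (2 * v + 1))"

lemma touched_cong: "S \<inter> leaves j v = T \<inter> leaves j v \<Longrightarrow> touched S j v = touched T j v"
proof (induction j arbitrary: v)
  case (Suc j)
  from Suc.prems have "S \<inter> leaves j (2 * v) = T \<inter> leaves j (2 * v)"
    "S \<inter> leaves j (2 * v + 1) = T \<inter> leaves j (2 * v + 1)"
    unfolding leaves_Suc by auto
  then have "touched S j (2 * v) = touched T j (2 * v)"
    "touched S j (2 * v + 1) = touched T j (2 * v + 1)"
    using Suc.IH by blast+
  then show ?case using Suc.prems by simp
qed auto

text \<open>Each set that meets \<open>U\<close> uses up at least one element of \<open>U\<close>,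
  and no element is used twice.\<close>

lemma sum_meets_le:
  fixes k :: nat
  assumes "disjoint_family_on S {..<k}" "finite U"
  shows "(\<Sum>r<k. if S r \<inter> U = {} then 0 else 1 :: nat) \<le> card U"
proof -
  have "(\<Sum>r<k. if S r \<inter> U = {} then 0 else 1 :: nat) \<le> (\<Sum>r<k. card (S r \<inter> U))"
    using assms(2) by (intro sum_mono) (auto simp: Suc_le_eq card_gt_0_iff)
  also have "\<dots> = card (\<Union>r<k. S r \<inter> U)"
    using assms by (subst card_UN_disjoint) (auto simp: disjoint_family_on_def)
  also have "\<dots> \<le> card U" using assms(2) by (intro card_mono) auto
  finally show ?thesis .
qed

text \<open>The top node counts at most once per round, and also at most once per leaf below it
  because each visit extracts one of them.\<close>

lemma sum_touched_Suc_le: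
  fixes k :: nat
  assumes "disjoint_family_on S {..<k}"
  shows "(\<Sum>r<k. touched (S r) (Suc j) v) \<le> min k (2 ^ Suc j) +
    (\<Sum>r<k. touched (S r) j (2 * v)) + (\<Sum>r<k. touched (S r) j (2 * v + 1))"
proof -
  let ?m = "\<lambda>r. if S r \<inter> leaves (Suc j) v = {} then 0 else 1 :: nat"
  have "(\<Sum>r<k. touched (S r) (Suc j) v) \<le>
      (\<Sum>r<k. ?m r + touched (S r) j (2 * v) + touched (S r) j (2 * v + 1))"
    by (intro sum_mono) auto
  moreover have "sum ?m {..<k} \<le> 2 ^ Suc j"
    using sum_meets_le[OF assms finite_leaves] by (simp only: card_leaves)
  moreover have "sum ?m {..<k} \<le> (\<Sum>r<k. 1)" by (intro sum_mono) auto
  ultimately show ?thesis by (simp add: sum.distrib)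
qed

text \<open>Each of the \<open>j + 1\<close> levels contributes at most the number
  \<open>2 ^ j\<close> of leaves.\<close>

lemma sum_touched_le_height:
  fixes k :: nat
  assumes "disjoint_family_on S {..<k}"
  shows "(\<Sum>r<k. touched (S r) j v) \<le> 2 ^ j * (j + 1)"
proof (induction j arbitrary: v)
  case 0
  have "(\<Sum>r<k. touched (S r) 0 v) = (\<Sum>r<k. if S r \<inter> {v} = {} then 0 else 1)"
    by (intro sum.cong) auto
  then show ?case using sum_meets_le[OF assms, of "{v}"] by simp
next
  case (Suc j)
  show ?case
    using sum_touched_Suc_le[OF assms, of j v] Suc[of "2 * v"] Suc[of "2 * v + 1"]
    by (simp add: algebra_simps)
qed

text \<open>
  The extra summand \<open>k\<close> doubles from level to level together with the rest, so that it absorbs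
  the at most \<open>k\<close> visits of the upper node.
\<close>

lemma sum_touched_le_ceil_log:
  fixes k :: nat
  assumes "disjoint_family_on S {..<k}" "k \<le> 2 ^ L" "L \<le> j"
  shows "(\<Sum>r<k. touched (S r) j v) + k \<le> 2 ^ j * (L + 2)"
  using assms(3)
proof (induction j arbitrary: v rule: dec_induct)
  case base
  then show ?case using sum_touched_le_height[OF assms(1), of L v] assms(2) by simp
next
  case (step j)
  show ?case
    using sum_touched_Suc_le[OF assms(1), of j v] step.IH[of "2 * v"] step.IH[of "2 * v + 1"]
    by (simp add: algebra_simps)
qed

text \<open>For a tree of height below \<open>L\<close> the bound by height is already strong
  enough.\<close>

lemma sum_touched_le:
  fixes k :: nat
  assumes "disjoint_family_on S {..<k}" "k \<le> 2 ^ L"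
  shows "(\<Sum>r<k. touched (S r) j v) \<le> 2 ^ j * (L + 2)"
proof (cases "L \<le> j")
  case True
  then show ?thesis using sum_touched_le_ceil_log[OF assms] add_leD1 by blast
next
  case False
  then have "(2::nat) ^ j * (j + 1) \<le> 2 ^ j * (L + 2)" by (intro mult_left_mono) auto
  then show ?thesis using sum_touched_le_height[OF assms(1)] le_trans by blast
qed

section \<open>Runs of the procedures\<close>

primrec tournament ::
  "(loc \<Rightarrow> 'a::linorder word) \<Rightarrow> (nat \<Rightarrow> 'a extended) \<Rightarrow> nat \<Rightarrow> nat \<Rightarrow> bool" where
  "tournament m x 0 v \<longleftrightarrow> m (Tree v) = Key (x v)"
| "tournament m x (Suc j) v \<longleftrightarrow> m (Tree v) = Key (Min (x ` leaves (Suc j) v)) \<and>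
     tournament m x j (2 * v) \<and> tournament m x j (2 * v + 1)"

lemma tournament_root: "tournament m x j v \<Longrightarrow> m (Tree v) = Key (Min (x ` leaves j v))"
  by (cases j) simp_all

lemma tournament_cong:
  "tournament m x j v \<Longrightarrow> \<forall>u\<in>subtree j v. m' (Tree u) = m (Tree u) \<Longrightarrow>
   \<forall>u\<in>leaves j v. x' u = x u \<Longrightarrow> tournament m' x' j v"
proof (induction j arbitrary: v)
  case (Suc j)
  have "x' ` leaves (Suc j) v = x ` leaves (Suc j) v" using Suc.prems(3) by (intro image_cong) auto
  moreover have "tournament m' x' j (2 * v)"
    by (rule Suc.IH) (use Suc.prems in \<open>auto simp: leaves_Suc\<close>)
  moreover have "tournament m' x' j (2 * v + 1)"
    by (rule Suc.IH) (use Suc.prems in \<open>auto simp: leaves_Suc\<close>)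
  ultimately show ?case using Suc.prems by simp
qed auto

lemma exec_update_min:
  assumes "m (Tree (2 * v)) = Key a" "m (Tree (2 * v + 1)) = Key b"
    "{Tree (2 * v), Tree (2 * v + 1)} \<subseteq> R" "Tree v \<in> W"
  shows "exec P R W (update_min v) m (m(Tree v := Key (min a b))) 4 4"
proof -
  have "exec P R W (update_min v) m (m(Tree v := Key (min a b)))
      (Suc (Suc (Suc (Suc 0)))) (Suc (Suc (Suc (Suc 0))))"
    unfolding update_min_def using assms
    by (intro exec_read exec_local exec_write) (auto intro: exec_halt)
  then show ?thesis by (simp add: eval_nat_numeral)
qed

lemma exec_call_halt:
  "exec P R W (P c) m m' w d \<Longrightarrow> exec P R W (Call c Halt) m m' (Suc w) (Suc d)"
  using exec_call[OF _ exec_halt] by fastforce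

lemma self_mem_subtree [simp]: "v \<in> subtree j v"
  by (cases j) auto

text \<open>The common inductive step for \<open>Build\<close> and \<open>PrefixMin\<close>. Two
  calls, the fork, the join and the four operations of \<open>update_min\<close> make 8; on a
  longest chain only one of the calls counts, which gives 7.\<close>

lemma exec_children:
  assumes ex: "exec P R1 W1 (P c1) m m1 w1 d1" "exec P R2 W2 (P c2) m m2 w2 d2"
    and sub: "R1 \<union> R2 \<subseteq> R" "W1 \<union> W2 \<subseteq> W" "W \<subseteq> R" "Tree v \<in> W"
      "Tree ` subtree j (2 * v) \<subseteq> W1" "Tree ` subtree j (2 * v + 1) \<subseteq> W2"
    and disj: "W1 \<inter> (R2 \<union> W2) = {}" "W2 \<inter> R1 = {}" "Tree v \<notin> W1 \<union> W2"
    and tour: "tournament m1 x j (2 * v)" "tournament m2 x j (2 * v + 1)"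
  obtains m' where
    "exec P R W (Fork (Call c1 Halt) (Call c2 Halt) (update_min v)) m m'
      (w1 + w2 + 8) (max d1 d2 + 7)"
    "tournament m' x (Suc j) v" "\<forall>l\<in>W1. m' l = m1 l" "\<forall>l\<in>W2. m' l = m2 l"
proof -
  let ?n = "override_on m1 m2 W2"
  let ?a = "Min (x ` leaves j (2 * v))" and ?b = "Min (x ` leaves j (2 * v + 1))"
  define m' where "m' = ?n(Tree v := Key (min ?a ?b))"
  have W1: "\<forall>l\<in>W1. l \<notin> W2" using disj by auto
  have n1: "\<forall>l\<in>W1. ?n l = m1 l" and n2: "\<forall>l\<in>W2. ?n l = m2 l"
    using W1 by (auto simp: override_on_def)
  have m'1: "\<forall>l\<in>W1. m' l = m1 l" and m'2: "\<forall>l\<in>W2. m' l = m2 l"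
    using n1 n2 disj(3) by (auto simp: m'_def)
  have t1: "\<forall>u\<in>subtree j (2 * v). Tree u \<in> W1" and t2: "\<forall>u\<in>subtree j (2 * v + 1). Tree u \<in> W2"
    using sub(5,6) by auto
  have "exec P R W (update_min v) ?n m' 4 4"
    unfolding m'_def
  proof (rule exec_update_min)
    show "?n (Tree (2 * v)) = Key ?a" using n1 t1 tournament_root[OF tour(1)] by simp
    show "?n (Tree (2 * v + 1)) = Key ?b" using n2 t2 tournament_root[OF tour(2)] by simp
    show "{Tree (2 * v), Tree (2 * v + 1)} \<subseteq> R"
      using t1[rule_format, of "2 * v"] t2[rule_format, of "2 * v + 1"] sub(2,3) by auto
  qed (rule sub(4))
  then have "exec P R W (Fork (Call c1 Halt) (Call c2 Halt) (update_min v)) m m'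
      (Suc w1 + Suc w2 + 4 + 2) (max (Suc d1) (Suc d2) + 4 + 2)"
    by (intro exec_fork[OF exec_call_halt[OF ex(1)] exec_call_halt[OF ex(2)]]) (use sub disj in auto)
  then have "exec P R W (Fork (Call c1 Halt) (Call c2 Halt) (update_min v)) m m'
      (w1 + w2 + 8) (max d1 d2 + 7)"
    by (simp add: eval_nat_numeral)
  moreover have "tournament m' x j (2 * v)"
    by (rule tournament_cong[OF tour(1)]) (use m'1 t1 in auto)
  moreover have "tournament m' x j (2 * v + 1)"
    by (rule tournament_cong[OF tour(2)]) (use m'2 t2 in auto)
  moreover have "min ?a ?b = Min (x ` leaves (Suc j) v)"
    unfolding leaves_Suc image_Un by (rule Min_Un[symmetric]) auto
  ultimately show ?thesis using that m'1 m'2 by (simp add: m'_def)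
qed

text \<open>A node of positive height has at least two leaves below it, all with index below
  \<open>2 * N\<close>; so the leaf test \<open>N \<le> v\<close> of the program fails at
  it.\<close>

lemma inner_node:
  fixes v N :: nat
  assumes "0 < N" "N \<le> v * 2 ^ Suc j" "(v + 1) * 2 ^ Suc j \<le> 2 * N"
  shows "\<not> N \<le> v" "0 < v"
proof -
  have "(v + 1) * 2 \<le> (v + 1) * 2 ^ Suc j" by (intro mult_left_mono) auto
  then have "(v + 1) * 2 \<le> 2 * N" using assms(3) by (rule le_trans)
  then show "\<not> N \<le> v" by simp
  show "0 < v" using assms(1,2) by (cases v) auto
qed

section \<open>Building the tree\<close>

text \<open>The summand 9 makes the induction close: a leaf costs at most 4, and an inner node adds
  9, namely its test and the 8 of \<open>exec_children\<close>. Each level adds 1 + 7 to the span.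
  The inputs are only read, so all threads may share them.\<close>

lemma exec_build:
  fixes A :: "'a::linorder list"
  assumes "\<forall>i<length A. m (Input i) = Key (Fin (A ! i))"
    and "0 < N" "N \<le> v * 2 ^ j" "(v + 1) * 2 ^ j \<le> 2 * N"
  shows "\<exists>m' w d. exec (lis_procs (length A)) (range Input \<union> Tree ` subtree j v)
      (Tree ` subtree j v) (lis_procs (length A) (Build N v)) m m' w d \<and>
    w + 9 \<le> 13 * 2 ^ j \<and> d \<le> 4 + 8 * j \<and> tournament m' (remaining A N 0) j v"
  using assms(3,4)
proof (induction j arbitrary: v)
  case 0
  let ?P = "lis_procs (length A) :: 'a name \<Rightarrow> 'a lis_prog"
  let ?m = "m(Tree v := Key (remaining A N 0 v))"
  let ?R = "range Input \<union> {Tree v}"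
  have x: "remaining A N 0 v = (if v - N < length A then Fin (A ! (v - N)) else Pinf)"
    using lis_rank_pos[of A "v - N"] by (auto simp: remaining_def)
  show ?case
  proof (cases "v - N < length A")
    case True
    have ex: "exec ?P ?R {Tree v} (?P (Build N v)) m ?m
        (Suc (Suc (Suc (Suc 0)))) (Suc (Suc (Suc (Suc 0))))"
      using 0 True assms(1) x
      by (auto intro!: exec_read exec_local exec_write intro: exec_halt)
    show ?thesis by (intro exI conjI, (simp only: subtree.simps image_insert image_empty, rule ex)) auto
  next
    case False
    have ex: "exec ?P ?R {Tree v} (?P (Build N v)) m ?m (Suc (Suc (Suc 0))) (Suc (Suc (Suc 0)))"
      using 0 False x by (auto intro!: exec_local exec_write intro: exec_halt)
    show ?thesis by (intro exI conjI, (simp only: subtree.simps image_insert image_empty, rule ex)) auto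
  qed
next
  case (Suc j)
  let ?P = "lis_procs (length A) :: 'a name \<Rightarrow> 'a lis_prog"
  let ?W = "Tree ` subtree (Suc j) v"
  let ?R = "range Input \<union> ?W"
  have v: "\<not> N \<le> v" "0 < v" using inner_node[OF assms(2) Suc.prems] .
  obtain m1 w1 d1 where
    1: "exec ?P (range Input \<union> Tree ` subtree j (2 * v)) (Tree ` subtree j (2 * v))
        (?P (Build N (2 * v))) m m1 w1 d1"
      "w1 + 9 \<le> 13 * 2 ^ j" "d1 \<le> 4 + 8 * j" "tournament m1 (remaining A N 0) j (2 * v)"
    using Suc.IH[of "2 * v"] Suc.prems by (auto simp: algebra_simps)
  obtain m2 w2 d2 where
    2: "exec ?P (range Input \<union> Tree ` subtree j (2 * v + 1)) (Tree ` subtree j (2 * v + 1))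
        (?P (Build N (2 * v + 1))) m m2 w2 d2"
      "w2 + 9 \<le> 13 * 2 ^ j" "d2 \<le> 4 + 8 * j" "tournament m2 (remaining A N 0) j (2 * v + 1)"
    using Suc.IH[of "2 * v + 1"] Suc.prems by (auto simp: algebra_simps)
  obtain m' where
    f: "exec ?P ?R ?W (Fork (Call (Build N (2 * v)) Halt) (Call (Build N (2 * v + 1)) Halt)
       (update_min v)) m m' (w1 + w2 + 8) (max d1 d2 + 7)"
    and t: "tournament m' (remaining A N 0) (Suc j) v"
    by (rule exec_children[OF 1(1) 2(1), of ?R ?W v j])
      (use subtree_children_disjoint[OF v(2)] subtree_children_not_mem[OF v(2)] 1(4) 2(4)
        in auto)
  have ex: "exec ?P ?R ?W (?P (Build N v)) m m' (Suc (w1 + w2 + 8)) (Suc (max d1 d2 + 7))"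
    using exec_local[OF f] v by simp
  show ?case by (intro exI conjI, rule ex) (use t 1(2,3) 2(2,3) in auto)
qed

section \<open>One round of extractions\<close>

text \<open>The cells that a call of \<open>PrefixMin\<close> at \<open>v\<close> may write.
  \<open>Round\<close> is kept out and added to the read sets only, so that siblings can share it
  without conflict.\<close>

definition footprint :: "nat \<Rightarrow> nat \<Rightarrow> nat \<Rightarrow> loc set" where
  "footprint N j v = Tree ` subtree j v \<union> (\<lambda>u. Rank (u - N)) ` leaves j v"

lemma footprint_Suc:
  "footprint N (Suc j) v =
     insert (Tree v) (footprint N j (2 * v) \<union> footprint N j (2 * v + 1))"
  by (auto simp: footprint_def leaves_Suc)

text \<open>The assumption on \<open>N\<close> keeps all leaves at or beyond \<open>N\<close>, where
  the truncated subtraction is strictly increasing; hence distinct leaves have distinct rank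
  cells.\<close>

lemma footprint_children_disjoint:
  assumes "0 < v" "N \<le> 2 * v * 2 ^ j"
  shows "footprint N j (2 * v) \<inter> footprint N j (2 * v + 1) = {}"
proof -
  have "u - N < u' - N" if "u \<in> leaves j (2 * v)" "u' \<in> leaves j (2 * v + 1)" for u u'
    using leaves_less[OF that] that(1) assms(2) by (auto simp: leaves_def)
  then show ?thesis
    using subtree_children_disjoint[OF assms(1), of j] unfolding footprint_def by fastforce
qed

text \<open>An immediate return costs 2. An inner node that is passed costs 5 operations before the
  fork, the 8 of \<open>exec_children\<close>, and the 2 of each child: 17 = 2 + 15. An extracted
  leaf costs 6. The span grows by 5 + 7 per level.\<close>

lemma exec_prefix_min:
  fixes x :: "nat \<Rightarrow> 'a::linorder extended"
  assumes "0 < N" "m Round = Num r"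
    and "N \<le> v * 2 ^ j" "(v + 1) * 2 ^ j \<le> 2 * N" "tournament m x j v"
    and "S = prefix_minima x (leaves j v) b"
  shows "\<exists>m' w d. exec (lis_procs n) (insert Round (footprint N j v)) (footprint N j v)
      (lis_procs n (PrefixMin N v b)) m m' w d \<and>
    w \<le> 2 + 15 * touched S j v \<and> d \<le> 6 + 12 * j \<and>
    tournament m' (\<lambda>u. if u \<in> S then Pinf else x u) j v \<and>
    (\<forall>u\<in>leaves j v. m' (Rank (u - N)) = (if u \<in> S then Num r else m (Rank (u - N))))"
  using assms(3-)
proof (induction j arbitrary: v b S)
  case (0 v b S)
  let ?P = "lis_procs n :: 'a name \<Rightarrow> 'a lis_prog"
  let ?W = "footprint N 0 v"
  let ?R = "insert Round ?W"
  have root: "m (Tree v) = Key (x v)" using 0 by simp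
  have W: "?W = {Tree v, Rank (v - N)}" by (auto simp: footprint_def)
  show ?case
  proof (cases "exceeds (x v) b")
    case True
    then have "S = {}" using 0 by (simp add: prefix_minima_def)
    have ex: "exec ?P ?R ?W (?P (PrefixMin N v b)) m m (Suc (Suc 0)) (Suc (Suc 0))"
      using True root by (auto intro!: exec_read exec_local exec_halt simp: W)
    show ?thesis by (intro exI conjI, rule ex) (use 0 \<open>S = {}\<close> in auto)
  next
    case False
    then have "S = {v}" using 0 by (auto simp: prefix_minima_def)
    have ex: "exec ?P ?R ?W (?P (PrefixMin N v b)) m
      (m(Rank (v - N) := Num r, Tree v := Key Pinf))
      (Suc (Suc (Suc (Suc (Suc (Suc 0)))))) (Suc (Suc (Suc (Suc (Suc (Suc 0))))))"
      using False root 0 assms(2)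
      by (auto intro!: exec_read exec_local exec_write exec_halt simp: W)
    show ?thesis by (intro exI conjI, rule ex) (use \<open>S = {v}\<close> in auto)
  qed
next
  case (Suc j v b S)
  let ?P = "lis_procs n :: 'a name \<Rightarrow> 'a lis_prog"
  let ?W = "footprint N (Suc j) v"
  let ?R = "insert Round ?W"
  let ?l = "2 * v" and ?r = "2 * v + 1"
  let ?a = "Min (x ` leaves (Suc j) v)"
  have root: "m (Tree v) = Key ?a" using Suc.prems by simp
  have W: "Tree v \<in> ?W" by (simp add: footprint_Suc)
  have S_iff: "S = {} \<longleftrightarrow> exceeds ?a b"
    unfolding \<open>S = _\<close> by (rule prefix_minima_empty_iff) auto
  have S_sub: "S \<subseteq> leaves (Suc j) v" unfolding \<open>S = _\<close> by (rule prefix_minima_subset)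
  show ?case
  proof (cases "S = {}")
    case True
    have ex: "exec ?P ?R ?W (?P (PrefixMin N v b)) m m (Suc (Suc 0)) (Suc (Suc 0))"
      using True S_iff root W by (auto intro!: exec_read exec_local exec_halt)
    show ?thesis by (intro exI conjI, rule ex) (use Suc.prems(3) True in auto)
  next
    case False
    have v: "\<not> N \<le> v" "0 < v" using inner_node[OF assms(1) Suc.prems(1,2)] .
    have N: "N \<le> 2 * v * 2 ^ j" using Suc.prems by (simp add: algebra_simps)
    let ?b = "min b (Min (x ` leaves j ?l))"
    define S1 where "S1 = prefix_minima x (leaves j ?l) b"
    define S2 where "S2 = prefix_minima x (leaves j ?r) ?b"
    have S: "S = S1 \<union> S2"
      unfolding \<open>S = _\<close> S1_def S2_def leaves_Suc
      by (rule prefix_minima_Un) (auto dest: leaves_less)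
    have sub: "S1 \<subseteq> leaves j ?l" "S2 \<subseteq> leaves j ?r"
      unfolding S1_def S2_def by (rule prefix_minima_subset)+
    \<comment> \<open>The two children have disjoint sets of leaves, so on the leaves of one child
      \<open>S\<close> is what is extracted there.\<close>
    have S1: "u \<in> S \<longleftrightarrow> u \<in> S1" if "u \<in> leaves j ?l" for u
      using that sub(2) leaves_less[OF that, of u] S by auto
    have S2: "u \<in> S \<longleftrightarrow> u \<in> S2" if "u \<in> leaves j ?r" for u
      using that sub(1) leaves_less[of u j v u] S by auto
    let ?x = "\<lambda>u. if u \<in> S then Pinf else x u"
    obtain m1 w1 d1 where
      1: "exec ?P (insert Round (footprint N j ?l)) (footprint N j ?l)
          (?P (PrefixMin N ?l b)) m m1 w1 d1"
        "w1 \<le> 2 + 15 * touched S1 j ?l" "d1 \<le> 6 + 12 * j"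
      and t1: "tournament m1 (\<lambda>u. if u \<in> S1 then Pinf else x u) j ?l"
      and r1: "\<forall>u\<in>leaves j ?l. m1 (Rank (u - N)) = (if u \<in> S1 then Num r else m (Rank (u - N)))"
      using Suc.IH[OF _ _ _ S1_def] Suc.prems by (auto simp: algebra_simps)
    obtain m2 w2 d2 where
      2: "exec ?P (insert Round (footprint N j ?r)) (footprint N j ?r)
          (?P (PrefixMin N ?r ?b)) m m2 w2 d2"
        "w2 \<le> 2 + 15 * touched S2 j ?r" "d2 \<le> 6 + 12 * j"
      and t2: "tournament m2 (\<lambda>u. if u \<in> S2 then Pinf else x u) j ?r"
      and r2: "\<forall>u\<in>leaves j ?r. m2 (Rank (u - N)) = (if u \<in> S2 then Num r else m (Rank (u - N)))"
      using Suc.IH[OF _ _ _ S2_def] Suc.prems by (auto simp: algebra_simps)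
    have t1': "tournament m1 ?x j ?l" by (rule tournament_cong[OF t1]) (use S1 in auto)
    have t2': "tournament m2 ?x j ?r" by (rule tournament_cong[OF t2]) (use S2 in auto)
    obtain m' where
      ex: "exec ?P ?R ?W (Fork (Call (PrefixMin N ?l b) Halt) (Call (PrefixMin N ?r ?b) Halt)
         (update_min v)) m m' (w1 + w2 + 8) (max d1 d2 + 7)"
      and t: "tournament m' ?x (Suc j) v"
      and m': "\<forall>l\<in>footprint N j ?l. m' l = m1 l" "\<forall>l\<in>footprint N j ?r. m' l = m2 l"
    proof (rule exec_children[OF 1(1) 2(1), of ?R ?W v j])
      show "footprint N j ?l \<inter> (insert Round (footprint N j ?r) \<union> footprint N j ?r) = {}"
        "footprint N j ?r \<inter> insert Round (footprint N j ?l) = {}"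
        using footprint_children_disjoint[OF v(2) N] by (auto simp: footprint_def)
      show "Tree v \<notin> footprint N j ?l \<union> footprint N j ?r"
        using subtree_children_not_mem[OF v(2), of j] by (auto simp: footprint_def)
      show "Tree ` subtree j ?l \<subseteq> footprint N j ?l" "Tree ` subtree j ?r \<subseteq> footprint N j ?r"
        by (auto simp: footprint_def)
    qed (use t1' t2' in \<open>auto simp: footprint_Suc\<close>)
    define w where "w = w1 + w2 + 8"
    define d where "d = max d1 d2 + 7"
    \<comment> \<open>The left value is read before the fork, so the bound handed to the right child
      is formed from the left minimum at the start, that is, it is \<open>?b\<close>.\<close>
    have "m (Tree ?l) = Key (Min (x ` leaves j ?l))"
      using Suc.prems(3) tournament_root by auto
    moreover have "Tree ?l \<in> ?R" by (auto simp: footprint_def)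
    ultimately have ex': "exec ?P ?R ?W (?P (PrefixMin N v b)) m m'
        (Suc (Suc (Suc (Suc (Suc w))))) (Suc (Suc (Suc (Suc (Suc d)))))"
      using S_iff False root v ex[folded w_def d_def] W by (auto intro!: exec_read exec_local)
    have cost: "touched S (Suc j) v = 1 + touched S1 j ?l + touched S2 j ?r"
    proof -
      have "touched S j ?l = touched S1 j ?l" "touched S j ?r = touched S2 j ?r"
        using S1 S2 by (intro touched_cong; blast)+
      moreover have "S \<inter> leaves (Suc j) v \<noteq> {}" using S_sub False by blast
      ultimately show ?thesis by simp
    qed
    have rank: "m' (Rank (u - N)) = (if u \<in> S then Num r else m (Rank (u - N)))"
      if "u \<in> leaves (Suc j) v" for u
    proof -
      from that consider "u \<in> leaves j ?l" | "u \<in> leaves j ?r" unfolding leaves_Suc by blast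
      then show ?thesis
      proof cases
        case 1
        then have "Rank (u - N) \<in> footprint N j ?l" by (auto simp: footprint_def)
        then show ?thesis using m'(1) r1 S1[OF 1] 1 by simp
      next
        case 2
        then have "Rank (u - N) \<in> footprint N j ?r" by (auto simp: footprint_def)
        then show ?thesis using m'(2) r2 S2[OF 2] 2 by simp
      qed
    qed
    show ?thesis
      by (intro exI conjI, rule ex') (use cost rank t 1(2,3) 2(2,3) in \<open>auto simp: w_def d_def\<close>)
  qed
qed


section \<open>The rounds and the main program\<close>

text \<open>After \<open>r\<close> rounds the tree holds the objects of rank above \<open>r\<close>,
  and all ranks up to \<open>r\<close> are stored; the induction goes from \<open>k\<close> down to
  \<open>r\<close>. A round takes 7 operations besides the body of \<open>PrefixMin\<close>, whose
  bounds contribute 2 and 6, whence 9 and 13. The outer 2 is the final test of the root.\<close>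

lemma exec_rounds:
  fixes A :: "'a::linorder list" and h :: nat
  defines "n \<equiv> length A" and "k \<equiv> lis_length A" and "N \<equiv> 2 ^ h"
  assumes "A \<noteq> []" "n \<le> N" "r \<le> k"
    and "m Round = Num r" "tournament m (remaining A N r) h 1"
    and "\<forall>i<n. lis_rank A i \<le> r \<longrightarrow> m (Rank i) = Num (lis_rank A i)"
  shows "\<exists>m' w d. exec (lis_procs n) UNIV UNIV (lis_procs n (Rounds N)) m m' w d \<and>
    w \<le> 2 + (\<Sum>s = r..<k. 9 + 15 * touched (layer A N s) h 1) \<and>
    d \<le> 2 + (k - r) * (13 + 12 * h) \<and>
    m' Round = Num k \<and> (\<forall>i<n. m' (Rank i) = Num (lis_rank A i))"
  using assms(6-)
proof (induction r arbitrary: m rule: inc_induct)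
  case (base m)
  let ?P = "lis_procs n :: 'a name \<Rightarrow> 'a lis_prog"
  have le: "\<forall>i<n. lis_rank A i \<le> k" using lis_length_bounds(3)[OF assms(4)] by (simp add: n_def k_def)
  then have "remaining A N k u = Pinf" for u
    by (cases "u - N < n") (auto simp: remaining_def n_def)
  then have "m (Tree 1) = Key Pinf"
    using tournament_root[OF base(2)] by (simp add: image_constant_conv)
  then have ex: "exec ?P UNIV UNIV (?P (Rounds N)) m m (Suc (Suc 0)) (Suc (Suc 0))"
    by (auto intro!: exec_read exec_local exec_halt)
  show ?case by (intro exI conjI, rule ex) (use base le in auto)
next
  case (step r m)
  let ?P = "lis_procs n :: 'a name \<Rightarrow> 'a lis_prog"
  let ?x = "remaining A N r"
  let ?m = "m(Round := Num (r + 1))"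
  have leaves: "leaves h 1 = {N..<2 * N}" by (simp add: leaves_def N_def mult_2)
  have root: "m (Tree 1) = Key (Min (?x ` leaves h 1))" using step.prems(2) by (rule tournament_root)
  \<comment> \<open>An object of rank \<open>k\<close> is still present because
    \<open>r < k\<close>, so the root is finite and another round starts.\<close>
  obtain i where i: "i < n" "lis_rank A i = k"
    using lis_length_bounds(4)[OF assms(4)] by (auto simp: n_def k_def)
  have "Min (?x ` leaves h 1) \<le> ?x (N + i)"
    unfolding leaves using i(1) assms(5) by (intro Min_le) auto
  moreover have "?x (N + i) \<noteq> Pinf" using i step.hyps by (simp add: remaining_def n_def)
  ultimately have not_Pinf: "Min (?x ` leaves h 1) \<noteq> Pinf" by auto
  have layer: "layer A N r = prefix_minima ?x (leaves h 1) Pinf"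
    unfolding leaves using assms(5) by (simp add: prefix_minima_remaining n_def)
  have "tournament ?m ?x h 1" by (rule tournament_cong[OF step.prems(2)]) auto
  then obtain m1 w1 d1 where
    1: "exec ?P (insert Round (footprint N h 1)) (footprint N h 1)
        (?P (PrefixMin N 1 Pinf)) ?m m1 w1 d1"
      "w1 \<le> 2 + 15 * touched (layer A N r) h 1" "d1 \<le> 6 + 12 * h"
    and t1: "tournament m1 (\<lambda>u. if u \<in> layer A N r then Pinf else ?x u) h 1"
    and r1: "\<forall>u\<in>leaves h 1. m1 (Rank (u - N)) =
        (if u \<in> layer A N r then Num (r + 1) else ?m (Rank (u - N)))"
    using exec_prefix_min[of N ?m "r + 1" 1 h ?x "layer A N r" Pinf n, OF _ _ _ _ _ layer]
    by (auto simp: N_def)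
  have round: "m1 Round = Num (Suc r)"
    using exec_unchanged[OF 1(1), of Round] by (auto simp: footprint_def)
  have "\<forall>u\<in>leaves h 1. N \<le> u" unfolding leaves by simp
  then have tour: "tournament m1 (remaining A N (Suc r)) h 1"
    by (intro tournament_cong[OF t1]) (auto simp: remaining_Suc)
  have rank: "\<forall>i<n. lis_rank A i \<le> Suc r \<longrightarrow> m1 (Rank i) = Num (lis_rank A i)"
  proof (intro allI impI)
    fix i assume i: "i < n" "lis_rank A i \<le> Suc r"
    then have "N + i \<in> leaves h 1" unfolding leaves using assms(5) by simp
    then have "m1 (Rank i) = (if N + i \<in> layer A N r then Num (r + 1) else m (Rank i))"
      using r1[rule_format, of "N + i"] by simp
    then show "m1 (Rank i) = Num (lis_rank A i)"
      using i step.prems(3) by (auto simp: layer_def n_def le_Suc_eq)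
  qed
  obtain m' w d where
    2: "exec ?P UNIV UNIV (?P (Rounds N)) m1 m' w d"
      "w \<le> 2 + (\<Sum>s = Suc r..<k. 9 + 15 * touched (layer A N s) h 1)"
      "d \<le> 2 + (k - Suc r) * (13 + 12 * h)"
      "m' Round = Num k" "\<forall>i<n. m' (Rank i) = Num (lis_rank A i)"
    using step.IH[OF round tour rank] by blast
  have "exec ?P UNIV UNIV (?P (PrefixMin N 1 Pinf)) ?m m1 w1 d1"
    by (rule exec_mono[OF 1(1)]) auto
  from exec_call[where c = "PrefixMin N 1 Pinf", OF this exec_call_halt[OF 2(1)]]
  have ex: "exec ?P UNIV UNIV (?P (Rounds N)) m m'
      (Suc (Suc (Suc (Suc (Suc (Suc (w1 + Suc w)))))))
      (Suc (Suc (Suc (Suc (Suc (Suc (d1 + Suc d)))))))"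
    using root not_Pinf step.prems(1)
    by (auto intro!: exec_read exec_local exec_write simp del: lis_procs.simps(4))
  have work: "(\<Sum>s = r..<k. 9 + 15 * touched (layer A N s) h 1) =
      9 + 15 * touched (layer A N r) h 1 + (\<Sum>s = Suc r..<k. 9 + 15 * touched (layer A N s) h 1)"
    using step.hyps(2) by (rule sum.atLeast_Suc_lessThan)
  have span: "(k - r) * (13 + 12 * h) = 13 + 12 * h + (k - Suc r) * (13 + 12 * h)"
    using step.hyps by (simp add: Suc_diff_Suc flip: mult_Suc)
  show ?case
    by (intro exI conjI, rule ex) (use work span 1(2,3) 2(2-) in auto)
qed

text \<open>Every power of two before \<open>2 ^ h\<close> is at most half of it and so below
  \<open>n\<close>; hence the doubling stops exactly at \<open>h\<close>, at 3 operations per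
  doubling. In the base case 4 operations and the 2 of \<open>Rounds\<close> make 6; the 4 of a leaf
  in \<open>Build\<close> raises this to 10 for the span.\<close>

lemma exec_main:
  fixes A :: "'a::linorder list"
  defines "n \<equiv> length A" and "k \<equiv> lis_length A"
  assumes "A \<noteq> []" "n \<le> 2 ^ h" "2 ^ h < 2 * n" "i \<le> h"
    and input: "\<forall>i<n. m (Input i) = Key (Fin (A ! i))"
  shows "\<exists>m' w d. exec (lis_procs n) UNIV UNIV (lis_procs n (Main (2 ^ i))) m m' w d \<and>
    w \<le> 3 * (h - i) + 6 + 13 * 2 ^ h + (\<Sum>s<k. 9 + 15 * touched (layer A (2 ^ h) s) h 1) \<and>
    d \<le> 3 * (h - i) + 10 + 8 * h + k * (13 + 12 * h) \<and>
    m' Round = Num k \<and> (\<forall>i<n. m' (Rank i) = Num (lis_rank A i))"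
  using assms(6)
proof (induction i rule: inc_induct)
  case base
  let ?P = "lis_procs n :: 'a name \<Rightarrow> 'a lis_prog"
  let ?N = "2 ^ h :: nat"
  obtain m1 w1 d1 where
    1: "exec ?P (range Input \<union> Tree ` subtree h 1) (Tree ` subtree h 1)
        (?P (Build ?N 1)) m m1 w1 d1"
      "w1 + 9 \<le> 13 * 2 ^ h" "d1 \<le> 4 + 8 * h" "tournament m1 (remaining A ?N 0) h 1"
    using exec_build[of A m ?N 1 h] input by (auto simp: n_def)
  let ?m = "m1(Round := Num 0)"
  have tour: "tournament ?m (remaining A ?N 0) h 1" by (rule tournament_cong[OF 1(4)]) auto
  have rank: "\<forall>i<n. lis_rank A i \<le> 0 \<longrightarrow> ?m (Rank i) = Num (lis_rank A i)"
    using lis_rank_pos[of A] by (metis not_le)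
  have "?m Round = Num 0" by simp
  then obtain m' w d where
    2: "exec ?P UNIV UNIV (?P (Rounds ?N)) ?m m' w d"
      "w \<le> 2 + (\<Sum>s = 0..<k. 9 + 15 * touched (layer A ?N s) h 1)"
      "d \<le> 2 + (k - 0) * (13 + 12 * h)"
      "m' Round = Num k" "\<forall>i<n. m' (Rank i) = Num (lis_rank A i)"
    using exec_rounds[of A h 0 ?m] assms(3,4) tour rank unfolding n_def k_def by blast
  have "exec ?P UNIV UNIV (?P (Build ?N 1)) m m1 w1 d1"
    by (rule exec_mono[OF 1(1)]) auto
  from exec_call[where c = "Build ?N 1", OF this exec_write[OF _ exec_call_halt[OF 2(1)]]]
  have ex: "exec ?P UNIV UNIV (?P (Main ?N)) m m'
      (Suc (Suc (w1 + Suc (Suc w)))) (Suc (Suc (d1 + Suc (Suc d))))"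
    using assms(4) by (auto intro!: exec_local simp del: lis_procs.simps(2,3))
  show ?case
    by (intro exI conjI, rule ex) (use 1(2,3) 2(2-) in \<open>auto simp: atLeast0LessThan\<close>)
next
  case (step i)
  let ?P = "lis_procs n :: 'a name \<Rightarrow> 'a lis_prog"
  have "(2::nat) * 2 ^ i \<le> 2 ^ h"
    using step.hyps power_increasing[of "Suc i" h "2::nat"] by simp
  then have "2 ^ i < n" using assms(5) by linarith
  from step.IH obtain m' w d where
    1: "exec ?P UNIV UNIV (?P (Main (2 ^ Suc i))) m m' w d"
      "w \<le> 3 * (h - Suc i) + 6 + 13 * 2 ^ h +
        (\<Sum>s<k. 9 + 15 * touched (layer A (2 ^ h) s) h 1)"
      "d \<le> 3 * (h - Suc i) + 10 + 8 * h + k * (13 + 12 * h)"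
      "m' Round = Num k" "\<forall>i<n. m' (Rank i) = Num (lis_rank A i)"
    by blast
  have ex: "exec ?P UNIV UNIV (?P (Main (2 ^ i))) m m' (Suc (Suc (Suc w))) (Suc (Suc (Suc d)))"
    using exec_local[OF exec_local[OF exec_call_halt[OF 1(1)]]] \<open>2 ^ i < n\<close>
    by (simp add: lis_procs.simps(1)[of n "2 ^ i"] del: lis_procs.simps)
  show ?case
    by (intro exI conjI, rule ex) (use 1(2-) step.hyps in auto)
qed

section \<open>Passing to logarithms\<close>

text \<open>The least exponent works: its predecessor fails, which gives
  \<open>2 ^ h < 2 * n\<close>, and \<open>lg n\<close> is the logarithm of
  \<open>2 * (n + 1)\<close>.\<close>

lemma ceil_log2:
  assumes "0 < n"
  obtains h where "n \<le> 2 ^ h" "2 ^ h < 2 * n" "real h \<le> lg n"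
proof -
  define h where "h = (LEAST h. n \<le> 2 ^ h)"
  have le: "n \<le> 2 ^ h" unfolding h_def by (rule LeastI[of _ n]) (simp add: less_imp_le)
  have less: "2 ^ h < 2 * n"
  proof (cases h)
    case (Suc h')
    then have "\<not> n \<le> 2 ^ h'" using not_less_Least[of h' "\<lambda>h. n \<le> 2 ^ h"] by (simp add: h_def)
    then show ?thesis using Suc by simp
  qed (use assms in simp)
  then have "real (2 ^ h) \<le> real (2 * (n + 1))" by (intro of_nat_mono) simp
  then have "2 ^ h \<le> 2 * (real n + 1)" by simp
  then have "log 2 (2 ^ h) \<le> log 2 (2 * (real n + 1))" by (intro log_mono) auto
  also have "log 2 (2 * (real n + 1)) = lg n" unfolding lg_def by (subst log_mult) auto
  finally have "real h \<le> lg n" by simp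
  then show ?thesis using that le less by blast
qed

lemma lg_ge_1: "1 \<le> lg n"
  by (simp add: lg_def)

lemma disjoint_layers: "disjoint_family_on (layer A N) S"
  by (auto simp: disjoint_family_on_def layer_def)

theorem theorem3p4:
  shows "\<exists>cw cs :: real. \<forall>(A :: 'a::linorder list) (m :: loc \<Rightarrow> 'a word).
    A \<noteq> [] \<longrightarrow> (\<forall>i<length A. m (Input i) = Key (Fin (A ! i))) \<longrightarrow>
    (\<forall>work s m'. (step (lis_procs (length A)) ^^ work) (lis_start, m) (s, m') \<longrightarrow>
       real work \<le> cw * real (length A) * lg (lis_length A) \<and>
       real (exec_span s) \<le> cs * real (lis_length A) * lg (length A) \<and>
       ((\<nexists>t. step (lis_procs (length A)) (s, m') t) \<longrightarrow>
          halted s \<and>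
          (\<forall>i<length A. m' (Rank i) = Num (lis_rank A i)) \<and>
          m' Round = Num (lis_length A)))"
\<comment> \<open>Since \<open>lg\<close> is at least 1, it absorbs the additive constants: 138 =
  108 + 30 for the work, and 47 = 22 + 25 for the span, where the LIS length being at least 1 is
  used as well.\<close>
proof (rule exI[of _ 138], rule exI[of _ 47], intro allI impI)
  fix A :: "'a list" and m m' :: "loc \<Rightarrow> 'a word" and work s
  assume A: "A \<noteq> []" and input: "\<forall>i<length A. m (Input i) = Key (Fin (A ! i))"
    and steps: "(step (lis_procs (length A)) ^^ work) (lis_start, m) (s, m')"
  let ?n = "length A" and ?k = "lis_length A"
  have k: "0 < ?k" "?k \<le> ?n" using lis_length_bounds[OF A] by auto
  obtain h where h: "?n \<le> 2 ^ h" "2 ^ h < 2 * ?n" "real h \<le> lg ?n"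
    using ceil_log2[of ?n] A by auto
  obtain L where L: "?k \<le> 2 ^ L" "real L \<le> lg ?k" using ceil_log2[OF k(1)] by blast
  obtain mf w d where
    ex: "exec (lis_procs ?n) UNIV UNIV (lis_procs ?n (Main (2 ^ 0))) m mf w d"
    and w: "w \<le> 3 * (h - 0) + 6 + 13 * 2 ^ h +
      (\<Sum>s<?k. 9 + 15 * touched (layer A (2 ^ h) s) h 1)"
    and d: "d \<le> 3 * (h - 0) + 10 + 8 * h + ?k * (13 + 12 * h)"
    and result: "mf Round = Num ?k" "\<forall>i<?n. mf (Rank i) = Num (lis_rank A i)"
    using exec_main[OF A h(1,2) _ input, of 0] by blast
  have ex': "exec (lis_procs ?n) UNIV UNIV (Call (Main 1) Halt) m mf (Suc w) (Suc d)"
    using exec_call_halt[OF ex] by simp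
  note sound = exec_sound[OF ex' steps[unfolded lis_start_def]]
  have "(\<Sum>s<?k. touched (layer A (2 ^ h) s) h 1) \<le> 2 ^ h * (L + 2)"
    by (rule sum_touched_le[OF disjoint_layers L(1)])
  also have "\<dots> \<le> 2 * ?n * (L + 2)" using h(2) by (intro mult_right_mono) auto
  finally have touched: "(\<Sum>s<?k. touched (layer A (2 ^ h) s) h 1) \<le> 2 * ?n * (L + 2)" .
  have "(\<Sum>s<?k. 9 + 15 * touched (layer A (2 ^ h) s) h 1) =
      9 * ?k + 15 * (\<Sum>s<?k. touched (layer A (2 ^ h) s) h 1)"
    by (simp add: sum.distrib flip: sum_distrib_left)
  moreover have "h < 2 * ?n" using h(2) less_exp[of h] by linarith
  moreover have "0 < ?n" using A by simp
  \<comment> \<open>48 = 7 + 6 + 26 + 9: the additive constants with the entry call, the doublings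
    through \<open>h < 2 * ?n\<close>, the construction of the tree through
    \<open>2 ^ h < 2 * ?n\<close>, and the fixed cost of the rounds through
    \<open>?k \<le> ?n\<close>.\<close>
  ultimately have "Suc w \<le> 48 * ?n + 15 * (2 * ?n * (L + 2))"
    using w touched h(2) k by linarith
  then have "real (Suc w) \<le> real (48 * ?n + 15 * (2 * ?n * (L + 2)))" by (rule of_nat_mono)
  also have "\<dots> = real ?n * (108 + 30 * real L)" by (simp add: algebra_simps)
  also have "\<dots> \<le> real ?n * (138 * lg ?k)"
    using L(2) lg_ge_1[of ?k] by (intro mult_left_mono) auto
  finally have work: "real work \<le> 138 * real ?n * lg ?k" using sound(1) by simp
  have "real (Suc d) \<le> real (11 + 11 * h + ?k * (13 + 12 * h))"
    using d by (intro of_nat_mono) simp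
  also have "\<dots> = 11 + 11 * real h + real ?k * (13 + 12 * real h)" by simp
  also have "\<dots> \<le> 22 * lg ?n + real ?k * (25 * lg ?n)"
    using h(3) lg_ge_1[of ?n] by (intro add_mono mult_left_mono) auto
  also have "22 * lg ?n \<le> real ?k * (22 * lg ?n)"
    using k(1) lg_ge_1[of ?n] by simp
  finally have "real (Suc d) \<le> 47 * real ?k * lg ?n" by (simp add: algebra_simps)
  then have "real (exec_span s) \<le> 47 * real ?k * lg ?n" using sound(2) by linarith
  then show "real work \<le> 138 * real ?n * lg ?k \<and>
      real (exec_span s) \<le> 47 * real ?k * lg ?n \<and>
      ((\<nexists>t. step (lis_procs ?n) (s, m') t) \<longrightarrow>
         halted s \<and> (\<forall>i<?n. m' (Rank i) = Num (lis_rank A i)) \<and> m' Round = Num ?k)"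
    using work sound(3) result by blast
qed

end
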